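(* Fix real constants $\epsilon>0$, $c>2$ and $c'>\frac{1+\epsilon}{\ln 2}$. There exists $k_0$ such that for every integer $k>k_0$ the following holds. Let $G$ be the random bipartite graph with left vertex set $L(G)$ of size $\lfloor c' k\ln k\rfloor$ and right vertex set $R(G)$ of size $\lfloor c k^2\rfloor$, in which each pair consisting of one vertex of $L(G)$ and one vertex of $R(G)$ is an edge with probability $1/2$, independently of the other pairs. Then $G$ is $k$-vertex-minor universal with probability at least $1-e^{-\epsilon k\ln k}$.
   Context: All graphs are finite, undirected and simple. In a bipartite graph the left and right vertex sets are disjoint, each is a stable set (no internal edges), and the full vertex set is their union. A local complementation on a vertex $v$ of $G$ complements the subgraph induced by the neighborhood of $v$: the resulting graph has the same vertex set and edge set $E(G)\oplus E(K_{N_G(v)})$, where $K_S$ is the complete graph on $S$ and $\oplus$ is symmetric difference. A graph $G'$ with $V(G')\subseteq V(G)$ is a vertex-minor of $G$ if $G'$ is obtained exactly (not only up to isomorphism) from $G$ by a sequence of local complementations and deletions of the vertices of $V(G)\setminus V(G')$. For an integer $k>0$, $G$ is $k$-vertex-minor universal if $k\leqslant |V(G)|$ and, for every set $K$ of $k$ vertices of $G$, every graph with vertex set $K$ is a vertex-minor of $G$. *)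

theory Defs
  imports "HOL-Probability.Probability" "HOL-Library.Ramsey"
begin

record 'a ugraph =
  verts :: "'a set"
  edges :: "'a set set"

definition simple_graph :: "'a ugraph \<Rightarrow> bool" where
  "simple_graph G \<longleftrightarrow> finite (verts G) \<and> edges G \<subseteq> nsets (verts G) 2"

definition neighborhood :: "'a ugraph \<Rightarrow> 'a \<Rightarrow> 'a set" where
  "neighborhood G v = {u. {u, v} \<in> edges G}"

text \<open>Here \<open>nsets S 2\<close> is the edge set of the complete graph on \<open>S\<close>.\<close>

definition local_complement :: "'a ugraph \<Rightarrow> 'a \<Rightarrow> 'a ugraph" where
  "local_complement G v =
     \<lparr>verts = verts G, edges = sym_diff (edges G) (nsets (neighborhood G v) 2)\<rparr>"

definition delete_vertex :: "'a ugraph \<Rightarrow> 'a \<Rightarrow> 'a ugraph" where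
  "delete_vertex G v = \<lparr>verts = verts G - {v}, edges = {e \<in> edges G. v \<notin> e}\<rparr>"

text \<open>
  \<open>vertex_minor G H\<close>: \<open>H\<close> is a vertex-minor of \<open>G\<close>. Deletions shrink the vertex set, so the
  vertices deleted on the way from \<open>G\<close> to \<open>H\<close> are exactly those of \<open>verts G - verts H\<close>.
\<close>

inductive vertex_minor :: "'a ugraph \<Rightarrow> 'a ugraph \<Rightarrow> bool" for G :: "'a ugraph" where
  refl: "vertex_minor G G"
| local_complement:
    "vertex_minor G H \<Longrightarrow> v \<in> verts H \<Longrightarrow> vertex_minor G (local_complement H v)"
| delete_vertex:
    "vertex_minor G H \<Longrightarrow> v \<in> verts H \<Longrightarrow> vertex_minor G (delete_vertex H v)"

definition vertex_minor_universal :: "nat \<Rightarrow> 'a ugraph \<Rightarrow> bool" where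
  "vertex_minor_universal k G \<longleftrightarrow>
     k \<le> card (verts G) \<and>
     (\<forall>K. K \<subseteq> verts G \<and> card K = k \<longrightarrow>
        (\<forall>H. simple_graph H \<and> verts H = K \<longrightarrow> vertex_minor G H))"

definition bipartite_graph :: "'a set \<Rightarrow> 'a set \<Rightarrow> ('a \<times> 'a \<Rightarrow> bool) \<Rightarrow> 'a ugraph" where
  "bipartite_graph L R X =
     \<lparr>verts = L \<union> R, edges = {{u, v} | u v. u \<in> L \<and> v \<in> R \<and> X (u, v)}\<rparr>"

text \<open>
  One independent fair coin per pair in \<open>L \<times> R\<close>; meant for finite disjoint \<open>L\<close> and \<open>R\<close>.
\<close>

definition random_bipartite_graph :: "'a set \<Rightarrow> 'a set \<Rightarrow> 'a ugraph pmf" where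
  "random_bipartite_graph L R =
     map_pmf (bipartite_graph L R) (Pi_pmf (L \<times> R) False (\<lambda>_. bernoulli_pmf (1 / 2)))"

lemma simple_graph_bipartite_graph:
  assumes "finite L" "finite R" "L \<inter> R = {}"
  shows "simple_graph (bipartite_graph L R X)"
  using assms by (auto simp: simple_graph_def bipartite_graph_def)

lemma simple_graph_vertex_minor:
  assumes "vertex_minor G H" "simple_graph G"
  shows "simple_graph H"
  using assms
proof (induction rule: vertex_minor.induct)
  case (local_complement H v)
  then have "neighborhood H v \<subseteq> verts H"
    by (auto simp: simple_graph_def neighborhood_def nsets_def)
  then have "nsets (neighborhood H v) 2 \<subseteq> nsets (verts H) 2"
    by (rule nsets_mono)
  with local_complement show ?case
    by (auto simp: simple_graph_def local_complement_def)
qed (auto simp: simple_graph_def delete_vertex_def nsets_def)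

end

theory Submission
  imports Defs "HOL-Real_Asymp.Real_Asymp"
begin

text \<open>
  Fix a set \<open>K\<close> of \<open>k\<close> vertices. Pivoting on an edge \<open>uv\<close> with \<open>u \<in> L - K\<close> and \<open>v \<in> K \<inter> R\<close> keeps the
  graph bipartite and exchanges the two vertices, so if the columns of \<open>K \<inter> R\<close>, restricted to the rows
  \<open>L - K\<close>, are linearly independent over the two-element field, then all of \<open>K\<close> can be moved to the
  left. Once \<open>K \<subseteq> L\<close>, a local complementation at a right vertex \<open>r\<close> toggles the clique on \<open>N(r) \<inter> K\<close>,
  and every graph on \<open>K\<close> is reached if these cliques span the edge space. By duality this means
  that no nonzero quadratic form on the space of subsets of \<open>K\<close> vanishes on all \<open>N(r) \<inter> K\<close>. Pivots act
  on the columns by invertible linear maps, which preserve quadratic forms; so it suffices that in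
  the original graph no nonzero quadratic form on any \<open>k\<close>-subset \<open>W\<close> of \<open>L\<close> vanishes on all columns
  of \<open>R - K\<close>.

  Linear independence fails with probability at most \<open>2^k * 2^(k - |L|)\<close>. A nonzero quadratic form
  vanishes on at most \<open>3/4\<close> of the space, and there are \<open>2^(k(k+1)/2)\<close> forms, so for fixed \<open>W\<close> the
  second condition fails with probability at most \<open>2^(k(k+1)/2) * (3/4)^(|R| - k)\<close>. Multiplied by the
  number \<open>exp (k ln k + O(k))\<close> of sets \<open>K\<close>, the first bound is small because \<open>c' ln 2 > 1 + \<epsilon>\<close>, the
  second because \<open>c > 2\<close>.
\<close>

subsection \<open>Pivots and vertex-minors\<close>

text \<open>As a relation on vertices, adjacency changes under local complementation by a Boolean
  formula, so compositions reduce to propositional reasoning.\<close>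

definition adjacent :: "'a ugraph \<Rightarrow> 'a \<Rightarrow> 'a \<Rightarrow> bool" where
  "adjacent G x y \<longleftrightarrow> {x, y} \<in> edges G"

lemma adjacent_local_complement:
  "adjacent (local_complement G v) x y \<longleftrightarrow>
     (adjacent G x y \<noteq> (x \<noteq> y \<and> adjacent G x v \<and> adjacent G y v))"
  by (auto simp: adjacent_def local_complement_def neighborhood_def)

text \<open>Every edge is a doubleton, so adjacency of pairs determines the edge set.
  \<open>A\<close> and \<open>B\<close> serve only to bound the edge sets by 2-element sets and may
  differ.\<close>

lemma ugraph_eqI:
  assumes "verts G = verts H" "edges G \<subseteq> nsets A 2" "edges H \<subseteq> nsets B 2"
    and "\<And>x y. adjacent G x y \<longleftrightarrow> adjacent H x y"
  shows "G = (H :: 'a ugraph)"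
proof -
  have "e \<in> edges G \<longleftrightarrow> e \<in> edges H" for e
  proof (cases "\<exists>x y. e = {x, y}")
    case True
    then show ?thesis using assms(4) by (auto simp: adjacent_def)
  next
    case False
    have "e \<notin> nsets C 2" for C using False by (metis nsets2_E)
    then show ?thesis using assms(2,3) by blast
  qed
  then show ?thesis using assms(1) by (intro ugraph.equality) auto
qed

lemma adjacent_bipartite_graph:
  "adjacent (bipartite_graph L R X) x y \<longleftrightarrow>
     x \<in> L \<and> y \<in> R \<and> X (x, y) \<or> y \<in> L \<and> x \<in> R \<and> X (y, x)"
  by (auto simp: adjacent_def bipartite_graph_def doubleton_eq_iff)

text \<open>
  Biadjacency after the pivot on the edge \<open>uv\<close>, with left side \<open>insert v (L - {u})\<close> and right side
  \<open>insert u (R - {v})\<close>.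
\<close>

definition pivot :: "'a \<Rightarrow> 'a \<Rightarrow> ('a \<times> 'a \<Rightarrow> bool) \<Rightarrow> 'a \<times> 'a \<Rightarrow> bool" where
  "pivot u v X = (\<lambda>(x, y).
     if x = v then y = u \<or> X (u, y)
     else if y = u then X (x, v)
     else X (x, y) \<noteq> (X (x, v) \<and> X (u, y)))"

lemma edges_local_complement_subset:
  assumes "edges G \<subseteq> nsets A 2"
  shows "edges (local_complement G v) \<subseteq> nsets A 2"
proof -
  have "neighborhood G v \<subseteq> A"
    using assms by (auto simp: neighborhood_def nsets_def)
  then show ?thesis
    using assms nsets_mono[of "neighborhood G v" A 2] by (auto simp: local_complement_def)
qed

text \<open>Pivoting on \<open>uv\<close> is local complementation at \<open>u\<close>,
  \<open>v\<close>, \<open>u\<close>. Each of the three only needs the current neighborhood of its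
  own vertex, so tracking the neighbors of \<open>u\<close> and \<open>v\<close> suffices.\<close>

lemma local_complement_pivot:
  assumes "L \<inter> R = {}" "u \<in> L" "v \<in> R" "X (u, v)"
  shows "local_complement (local_complement (local_complement (bipartite_graph L R X) u) v) u =
         bipartite_graph (insert v (L - {u})) (insert u (R - {v})) (pivot u v X)"
    (is "?G = ?H")
proof (rule ugraph_eqI)
  have bip: "edges (bipartite_graph L' R' Y) \<subseteq> nsets (L' \<union> R') 2" if "L' \<inter> R' = {}" for L' R' and Y :: "'a \<times> 'a \<Rightarrow> bool"
    using that by (auto simp: bipartite_graph_def)
  show "verts ?G = verts ?H"
    using assms by (auto simp: local_complement_def bipartite_graph_def)
  show "edges ?G \<subseteq> nsets (L \<union> R) 2"
    using assms by (intro edges_local_complement_subset bip)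
  show "edges ?H \<subseteq> nsets (insert v (L - {u}) \<union> insert u (R - {v})) 2"
    using assms by (intro bip) auto
  let ?G1 = "local_complement (bipartite_graph L R X) u"
  let ?G2 = "local_complement ?G1 v"
  \<comment> \<open>\<open>p\<close> is the neighborhood of \<open>u\<close> before and after the
    first complementation, \<open>s\<close> and \<open>t\<close> are those of \<open>v\<close>
    before and after it, and \<open>w\<close> is that of \<open>u\<close> after the second.\<close>
  define p where "p x \<longleftrightarrow> x \<in> R \<and> X (u, x)" for x
  define s where "s x \<longleftrightarrow> x \<in> L \<and> X (x, v)" for x
  define t where "t x \<longleftrightarrow> s x \<or> p x \<and> x \<noteq> v" for x
  define w where "w x \<longleftrightarrow> x = v \<or> s x \<and> x \<noteq> u" for x
  have ns: "u \<notin> R" "v \<notin> L" "u \<noteq> v" and disj: "\<And>x. x \<in> L \<Longrightarrow> x \<notin> R" using assms by auto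
  have adj0: "adjacent (bipartite_graph L R X) x u \<longleftrightarrow> p x"
      "adjacent (bipartite_graph L R X) x v \<longleftrightarrow> s x" for x
    using ns assms(2-4) by (auto simp: adjacent_bipartite_graph p_def s_def)
  have adj1: "adjacent ?G1 x u \<longleftrightarrow> p x" "adjacent ?G1 x v \<longleftrightarrow> t x" for x
    using ns assms(2-4) disj[of x]
    by (auto simp: adjacent_local_complement adj0) (auto simp: p_def s_def t_def)
  have adj2: "adjacent ?G2 x u \<longleftrightarrow> w x" for x
    using ns assms(2-4) disj[of x]
    by (auto simp: adjacent_local_complement[of ?G1] adj1) (auto simp: p_def s_def t_def w_def)
  show "adjacent ?G x y \<longleftrightarrow> adjacent ?H x y" for x y
  proof -
    have *: "adjacent ?G x y \<longleftrightarrow>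
        (((adjacent (bipartite_graph L R X) x y \<noteq> (x \<noteq> y \<and> p x \<and> p y)) \<noteq>
          (x \<noteq> y \<and> t x \<and> t y)) \<noteq> (x \<noteq> y \<and> w x \<and> w y))"
      unfolding adjacent_local_complement[of ?G2] adj2
      unfolding adjacent_local_complement[of ?G1] adj1
      unfolding adjacent_local_complement adj0 ..
    note ** = ns assms(2-4) disj[of x] disj[of y]
    show ?thesis
      unfolding * adjacent_bipartite_graph
    proof (cases "x = u \<or> x = v \<or> y = u \<or> y = v \<or> x = y")
      case True
      then show "(((x \<in> L \<and> y \<in> R \<and> X (x, y) \<or> y \<in> L \<and> x \<in> R \<and> X (y, x)) \<noteq> (x \<noteq> y \<and> p x \<and> p y)) \<noteq>
          (x \<noteq> y \<and> t x \<and> t y)) \<noteq> (x \<noteq> y \<and> w x \<and> w y) \<longleftrightarrow>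
          x \<in> insert v (L - {u}) \<and> y \<in> insert u (R - {v}) \<and> pivot u v X (x, y) \<or>
          y \<in> insert v (L - {u}) \<and> x \<in> insert u (R - {v}) \<and> pivot u v X (y, x)"
        using ** by (elim disjE) (auto simp: p_def s_def t_def w_def pivot_def)
    next
      case False
      then have "x \<noteq> u" "x \<noteq> v" "y \<noteq> u" "y \<noteq> v" "x \<noteq> y" by auto
      then show "(((x \<in> L \<and> y \<in> R \<and> X (x, y) \<or> y \<in> L \<and> x \<in> R \<and> X (y, x)) \<noteq> (x \<noteq> y \<and> p x \<and> p y)) \<noteq>
          (x \<noteq> y \<and> t x \<and> t y)) \<noteq> (x \<noteq> y \<and> w x \<and> w y) \<longleftrightarrow>
          x \<in> insert v (L - {u}) \<and> y \<in> insert u (R - {v}) \<and> pivot u v X (x, y) \<or>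
          y \<in> insert v (L - {u}) \<and> x \<in> insert u (R - {v}) \<and> pivot u v X (y, x)"
        using **(6-8)
        by (cases "x \<in> L"; cases "y \<in> L"; cases "x \<in> R"; cases "y \<in> R";
            auto simp: p_def s_def t_def w_def pivot_def)
    qed
  qed
qed

lemma vertex_minor_trans:
  assumes "vertex_minor H I" "vertex_minor G H"
  shows "vertex_minor G I"
  using assms by induction (auto intro: vertex_minor.intros)

lemma vertex_minor_pivot:
  assumes "L \<inter> R = {}" "u \<in> L" "v \<in> R" "X (u, v)"
  shows "vertex_minor (bipartite_graph L R X)
     (bipartite_graph (insert v (L - {u})) (insert u (R - {v})) (pivot u v X))"
  unfolding local_complement_pivot[where X = X, OF assms, symmetric]
  by (intro vertex_minor.intros)
    (use assms in \<open>auto simp: local_complement_def bipartite_graph_def\<close>)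

definition induced_subgraph :: "'a ugraph \<Rightarrow> 'a set \<Rightarrow> 'a ugraph" where
  "induced_subgraph G K = \<lparr>verts = K, edges = {e \<in> edges G. e \<subseteq> K}\<rparr>"

lemma vertex_minor_induced_subgraph:
  assumes "simple_graph G" "K \<subseteq> verts G"
  shows "vertex_minor G (induced_subgraph G K)"
proof -
  have "vertex_minor G (induced_subgraph G (verts G - D))" if "D \<subseteq> verts G" for D
  proof -
    have "finite D" using that assms by (auto simp: simple_graph_def finite_subset)
    then show ?thesis using that
    proof (induction D)
      case empty
      have "induced_subgraph G (verts G) = G"
        using assms(1)
        by (intro ugraph.equality) (auto simp: induced_subgraph_def simple_graph_def nsets_def)
      then show ?case by (simp add: vertex_minor.refl)
    next
      case (insert v D)
      have "induced_subgraph G (verts G - insert v D) =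
          delete_vertex (induced_subgraph G (verts G - D)) v"
        by (auto simp: induced_subgraph_def delete_vertex_def)
      then show ?case
        using insert by (auto intro!: vertex_minor.delete_vertex simp: induced_subgraph_def)
    qed
  qed
  from this[of "verts G - K"] show ?thesis
    using assms(2) by (simp add: double_diff)
qed

subsection \<open>Quadratic functions over the two-element field\<close>

text \<open>The linear span over the two-element field. Adding one generator at a time lets
  induction follow a sequence of local complementations.\<close>

inductive_set xor_span :: "'a set set \<Rightarrow> 'a set set" for \<F> where
  empty: "{} \<in> xor_span \<F>"
| sym_diff: "D \<in> xor_span \<F> \<Longrightarrow> C \<in> \<F> \<Longrightarrow> sym_diff D C \<in> xor_span \<F>"

lemma odd_card_sym_diff:
  assumes "finite A" "finite B"
  shows "odd (card (sym_diff A B)) \<longleftrightarrow> odd (card A) \<noteq> odd (card B)"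
proof -
  have "card (sym_diff A B) = card (A - B) + card (B - A)"
    using assms by (intro card_Un_disjoint) auto
  moreover have "card A = card (A - B) + card (A \<inter> B)" "card B = card (B - A) + card (A \<inter> B)"
    using assms by (metis add.commute card_Int_Diff inf_commute)+
  ultimately show ?thesis by auto
qed

text \<open>A proper subspace is annihilated by a nonzero linear functional, here the parity of the
  intersection with \<open>Q\<close>. By induction on \<open>E\<close>, a functional is found for
  the members avoiding \<open>e\<close> and then extended to \<open>e\<close>; if no member contains
  \<open>e\<close>, then \<open>{e}\<close> works.\<close>

lemma exists_orthogonal_set:
  assumes "finite E" "\<F> \<subset> Pow E" "{} \<in> \<F>"
    and "\<And>A B. A \<in> \<F> \<Longrightarrow> B \<in> \<F> \<Longrightarrow> sym_diff A B \<in> \<F>"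
  shows "\<exists>Q\<subseteq>E. Q \<noteq> {} \<and> (\<forall>A\<in>\<F>. even (card (Q \<inter> A)))"
  using assms
proof (induction E arbitrary: \<F>)
  case empty
  then show ?case by auto
next
  case (insert e E)
  show ?case
  proof (cases "\<exists>B\<in>\<F>. e \<in> B")
    case False
    then show ?thesis by (intro exI[of _ "{e}"]) auto
  next
    case True
    then obtain B where B: "B \<in> \<F>" "e \<in> B" by auto
    define \<F>' where "\<F>' = {A \<in> \<F>. e \<notin> A}"
    \<comment> \<open>If the members avoiding \<open>e\<close> exhausted \<open>Pow E\<close>,
      adding \<open>B\<close> to them would give every set containing \<open>e\<close>.\<close>
    have "\<F>' \<noteq> Pow E"
    proof
      assume eq: "\<F>' = Pow E"
      have "A \<in> \<F>" if "A \<subseteq> insert e E" for A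
      proof (cases "e \<in> A")
        case True
        have BE: "B \<subseteq> insert e E" using B insert.prems(1) by auto
        have "sym_diff A B \<in> Pow E" using that True B BE by auto
        then have "sym_diff A B \<in> \<F>" using eq by (auto simp: \<F>'_def)
        from insert.prems(3)[OF this B(1)] show ?thesis
          by (rule back_subst[of "\<lambda>x. x \<in> \<F>"]) auto
      next
        case False
        then have "A \<in> \<F>'" using that eq by auto
        then show ?thesis by (simp add: \<F>'_def)
      qed
      then show False using insert.prems(1) by auto
    qed
    then have "\<exists>Q\<subseteq>E. Q \<noteq> {} \<and> (\<forall>A\<in>\<F>'. even (card (Q \<inter> A)))"
      using insert.prems by (intro insert.IH) (auto simp: \<F>'_def)
    then obtain Q where Q: "Q \<subseteq> E" "Q \<noteq> {}" "\<And>A. A \<in> \<F>' \<Longrightarrow> even (card (Q \<inter> A))" by blast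
    \<comment> \<open>Membership of \<open>e\<close> is chosen to make the parity on
      \<open>B\<close> even. Every other member containing \<open>e\<close> differs from
      \<open>B\<close> by an element of \<open>\<F>'\<close>, so its parity is even as well.\<close>
    define Q' where "Q' = (if even (card (Q \<inter> B)) then Q else insert e Q)"
    have fin: "finite Q" using Q(1) insert.hyps finite_subset by auto
    have e: "e \<notin> Q" using Q insert.hyps by auto
    have "even (card (Q' \<inter> A))" if "A \<in> \<F>" for A
    proof (cases "e \<in> A")
      case False
      then have "Q' \<inter> A = Q \<inter> A" by (auto simp: Q'_def)
      then show ?thesis using Q(3) that False by (simp add: \<F>'_def)
    next
      case True
      have "sym_diff A B \<in> \<F>'" using True B that insert.prems(3) by (auto simp: \<F>'_def)
      then have "even (card (Q \<inter> sym_diff A B))" by (rule Q(3))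
      moreover have "Q \<inter> sym_diff A B = sym_diff (Q \<inter> A) (Q \<inter> B)" by auto
      ultimately have "odd (card (Q \<inter> A)) = odd (card (Q \<inter> B))"
        using odd_card_sym_diff[of "Q \<inter> A" "Q \<inter> B"] fin by simp
      then show ?thesis using True e fin by (auto simp: Q'_def Int_insert_left)
    qed
    moreover have "Q' \<subseteq> insert e E" "Q' \<noteq> {}" using Q by (auto simp: Q'_def)
    ultimately show ?thesis by blast
  qed
qed

lemma xor_span_eq_Pow:
  assumes "finite E" "\<And>C. C \<in> \<C> \<Longrightarrow> C \<subseteq> E"
    and "\<And>Q. Q \<subseteq> E \<Longrightarrow> Q \<noteq> {} \<Longrightarrow> \<exists>C\<in>\<C>. odd (card (Q \<inter> C))"
  shows "xor_span \<C> = Pow E"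
proof (rule ccontr)
  assume neq: "xor_span \<C> \<noteq> Pow E"
  have "D \<subseteq> E" if "D \<in> xor_span \<C>" for D
    using that by induction (use assms(2) in auto)
  moreover have "sym_diff A B \<in> xor_span \<C>" if "A \<in> xor_span \<C>" "B \<in> xor_span \<C>" for A B
    using that(2)
  proof induction
    case (sym_diff D C)
    have "sym_diff A (sym_diff D C) = sym_diff (sym_diff A D) C" by auto
    then show ?case using sym_diff by (metis xor_span.sym_diff)
  qed (use that(1) in simp)
  ultimately have "\<exists>Q\<subseteq>E. Q \<noteq> {} \<and> (\<forall>A\<in>xor_span \<C>. even (card (Q \<inter> A)))"
    using neq assms(1) by (intro exists_orthogonal_set xor_span.empty) auto
  then obtain Q where "Q \<subseteq> E" "Q \<noteq> {}" "\<forall>A\<in>xor_span \<C>. even (card (Q \<inter> A))" by auto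
  moreover have "C \<in> xor_span \<C>" if "C \<in> \<C>" for C
    using xor_span.sym_diff[OF xor_span.empty that] by simp
  ultimately show False using assms(3) by blast
qed

text \<open>
  Subsets of \<open>W\<close> form a vector space over the two-element field under \<open>sym_diff\<close>; a function on
  it is a polynomial of degree at most 2 without constant term iff its third differences at 0 vanish.
\<close>

definition quadratic_on :: "'a set \<Rightarrow> ('a set \<Rightarrow> bool) \<Rightarrow> bool" where
  "quadratic_on W q \<longleftrightarrow> (\<forall>x y z. x \<subseteq> W \<longrightarrow> y \<subseteq> W \<longrightarrow> z \<subseteq> W \<longrightarrow>
     q (sym_diff x (sym_diff y z)) =
       (q (sym_diff x y) \<noteq> (q (sym_diff x z) \<noteq> (q (sym_diff y z) \<noteq> (q x \<noteq> (q y \<noteq> q z))))))"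

lemma quadratic_onD:
  assumes "quadratic_on W q" "x \<subseteq> W" "y \<subseteq> W" "z \<subseteq> W"
  shows "q (sym_diff x (sym_diff y z)) =
       (q (sym_diff x y) \<noteq> (q (sym_diff x z) \<noteq> (q (sym_diff y z) \<noteq> (q x \<noteq> (q y \<noteq> q z)))))"
  using assms by (simp add: quadratic_on_def)

lemma quadratic_on_xor:
  assumes "quadratic_on W q" "quadratic_on W q'"
  shows "quadratic_on W (\<lambda>x. q x \<noteq> q' x)"
  unfolding quadratic_on_def
proof (intro allI impI)
  fix x y z assume "x \<subseteq> W" "y \<subseteq> W" "z \<subseteq> W"
  note * = quadratic_onD[OF assms(1) this] quadratic_onD[OF assms(2) this]
  show "(q (sym_diff x (sym_diff y z)) \<noteq> q' (sym_diff x (sym_diff y z))) =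
    ((q (sym_diff x y) \<noteq> q' (sym_diff x y)) \<noteq> ((q (sym_diff x z) \<noteq> q' (sym_diff x z)) \<noteq>
     ((q (sym_diff y z) \<noteq> q' (sym_diff y z)) \<noteq> ((q x \<noteq> q' x) \<noteq> ((q y \<noteq> q' y) \<noteq> (q z \<noteq> q' z))))))"
    unfolding * by argo
qed

lemma quadratic_on_monomial: "quadratic_on W (\<lambda>x. a \<in> x \<and> b \<in> x)"
  unfolding quadratic_on_def Un_iff Diff_iff
  by (intro allI impI, argo)

text \<open>The parity is the sum of the monomials \<open>x_a x_b\<close> over the edges
  \<open>ab\<close> of \<open>Q\<close>. Thus a functional on edge sets, evaluated at cliques,
  becomes a quadratic form in the vertex set of the clique.\<close>

lemma quadratic_on_odd_card_edges:
  assumes "finite Q" "Q \<subseteq> nsets K 2"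
  shows "quadratic_on W (\<lambda>x. odd (card (Q \<inter> nsets x 2)))"
  using assms
proof (induction Q)
  case empty
  then show ?case by (simp add: quadratic_on_def)
next
  case (insert e Q)
  obtain a b where e: "e = {a, b}" "a \<noteq> b" using insert.prems by (auto elim: nsets2_E)
  have "odd (card (insert e Q \<inter> nsets x 2)) =
      ((a \<in> x \<and> b \<in> x) \<noteq> odd (card (Q \<inter> nsets x 2)))" for x
    using insert.hyps e by (cases "a \<in> x"; cases "b \<in> x") (simp_all add: Int_insert_left)
  then show ?case
    using insert by (simp only:) (intro quadratic_on_xor quadratic_on_monomial, auto)
qed

subsection \<open>Moving a vertex set to the left side\<close>

text \<open>Only pairs inside \<open>L\<close> are ever toggled, so each right vertex keeps its
  original neighborhood and the toggled cliques simply add up.\<close>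

lemma vertex_minor_toggle_cliques:
  assumes "L \<inter> R = {}" "D \<in> xor_span ((\<lambda>r. nsets {l \<in> L. X (l, r)} 2) ` R)"
  shows "D \<subseteq> nsets L 2 \<and> vertex_minor (bipartite_graph L R X)
    \<lparr>verts = L \<union> R, edges = edges (bipartite_graph L R X) \<union> D\<rparr>"
  using assms(2)
proof induction
  case empty
  have "\<lparr>verts = L \<union> R, edges = edges (bipartite_graph L R X) \<union> {}\<rparr> = bipartite_graph L R X"
    by (simp add: bipartite_graph_def)
  then show ?case by (metis vertex_minor.refl empty_subsetI)
next
  case (sym_diff D C)
  then obtain r where r: "r \<in> R" "C = nsets {l \<in> L. X (l, r)} 2" by auto
  let ?G = "\<lparr>verts = L \<union> R, edges = edges (bipartite_graph L R X) \<union> D\<rparr>"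
  have D: "D \<subseteq> nsets L 2" and minor: "vertex_minor (bipartite_graph L R X) ?G"
    using sym_diff by auto
  have C: "C \<subseteq> nsets L 2" unfolding r by (intro nsets_mono) auto
  have "{u, r} \<notin> D" for u using D r assms(1) by (auto simp: nsets_def)
  then have nb: "neighborhood ?G r = {l \<in> L. X (l, r)}"
    using r assms(1) by (auto simp: neighborhood_def bipartite_graph_def doubleton_eq_iff)
  have "edges (bipartite_graph L R X) \<inter> nsets L 2 = {}"
    using assms(1) by (auto simp: bipartite_graph_def)
  then have "local_complement ?G r =
      \<lparr>verts = L \<union> R, edges = edges (bipartite_graph L R X) \<union> sym_diff D C\<rparr>"
    using C D unfolding local_complement_def nb r(2)[symmetric] by auto
  moreover have "vertex_minor (bipartite_graph L R X) (local_complement ?G r)"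
    using minor r(1) by (intro vertex_minor.local_complement) auto
  ultimately show ?case using C D by auto
qed

text \<open>Linear independence of columns, spelled out over the two-element field: no nonempty set
  of columns sums to zero on the rows outside \<open>K\<close>.\<close>

definition rank_condition :: "'a set \<Rightarrow> 'a set \<Rightarrow> ('a \<times> 'a \<Rightarrow> bool) \<Rightarrow> 'a set \<Rightarrow> bool" where
  "rank_condition L R X K \<longleftrightarrow>
     (\<forall>S\<subseteq>K \<inter> R. S \<noteq> {} \<longrightarrow> (\<exists>l\<in>L - K. odd (card {r \<in> S. X (l, r)})))"

text \<open>
  Quantifying over all \<open>W\<close> rather than just \<open>W = K\<close> makes the condition invariant under pivots.
\<close>

definition quadric_condition :: "'a set \<Rightarrow> 'a set \<Rightarrow> ('a \<times> 'a \<Rightarrow> bool) \<Rightarrow> 'a set \<Rightarrow> bool" where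
  "quadric_condition L R X K \<longleftrightarrow>
     (\<forall>W q. K \<inter> L \<subseteq> W \<and> W \<subseteq> L \<and> card W = card K \<and> quadratic_on W q \<and> (\<exists>x\<subseteq>W. q x) \<longrightarrow>
        (\<exists>r\<in>R - K. q {l \<in> W. X (l, r)}))"

text \<open>First \<open>L - K\<close> is deleted, so that right neighborhoods lie inside
  \<open>K\<close>; then cliques are toggled until \<open>K\<close> carries the edges of
  \<open>H\<close>; finally \<open>R\<close> is deleted.\<close>

lemma vertex_minor_of_left_set:
  assumes "finite L" "finite R" "L \<inter> R = {}" "K \<subseteq> L" "quadric_condition L R X K"
    and H: "simple_graph H" "verts H = K"
  shows "vertex_minor (bipartite_graph L R X) H"
proof -
  let ?C = "(\<lambda>r. nsets {l \<in> K. X (l, r)} 2) ` R"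
  let ?G = "\<lparr>verts = K \<union> R, edges = edges (bipartite_graph K R X) \<union> edges H\<rparr>"
  have disj: "K \<inter> R = {}" and fin: "finite K" using assms finite_subset by auto
  have "xor_span ?C = Pow (nsets K 2)"
  proof (rule xor_span_eq_Pow)
    show "finite (nsets K 2)" using fin by (simp add: finite_imp_finite_nsets)
    show "C \<subseteq> nsets K 2" if "C \<in> ?C" for C
      using that nsets_mono[of "{l \<in> K. X (l, _)}" K] by blast
    fix Q assume Q: "Q \<subseteq> nsets K 2" "Q \<noteq> {}"
    then have finQ: "finite Q" using fin by (metis finite_imp_finite_nsets finite_subset)
    obtain e where e: "e \<in> Q" using Q by auto
    \<comment> \<open>This shows that the form attached to \<open>Q\<close> is nonzero: at
      \<open>x = e\<close> the only edge of \<open>Q\<close> that it counts is \<open>e\<close>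
      itself.\<close>
    have "nsets e 2 = {e}" using e Q by (auto elim!: nsets2_E[of _ K])
    then have "odd (card (Q \<inter> nsets e 2))" using e by simp
    moreover have "e \<subseteq> K" using e Q by (auto simp: nsets_def)
    ultimately have "\<exists>x\<subseteq>K. odd (card (Q \<inter> nsets x 2))" by auto
    then have "\<exists>r\<in>R - K. odd (card (Q \<inter> nsets {l \<in> K. X (l, r)} 2))"
      using assms(4,5) quadratic_on_odd_card_edges[OF finQ Q(1), of K]
      unfolding quadric_condition_def by blast
    then show "\<exists>C\<in>?C. odd (card (Q \<inter> C))" by auto
  qed
  then have "edges H \<in> xor_span ?C" using H by (simp add: simple_graph_def)
  then have 1: "vertex_minor (bipartite_graph K R X) ?G"
    using vertex_minor_toggle_cliques[OF disj] by blast
  have "e \<in> edges (bipartite_graph L R X) \<and> e \<subseteq> K \<union> R \<longleftrightarrow> e \<in> edges (bipartite_graph K R X)" for e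
  proof
    assume "e \<in> edges (bipartite_graph L R X) \<and> e \<subseteq> K \<union> R"
    then obtain l r where "e = {l, r}" "l \<in> L" "r \<in> R" "X (l, r)" "l \<in> K \<union> R"
      by (auto simp: bipartite_graph_def)
    then show "e \<in> edges (bipartite_graph K R X)"
      using assms(3) by (auto simp: bipartite_graph_def)
  next
    assume "e \<in> edges (bipartite_graph K R X)"
    then show "e \<in> edges (bipartite_graph L R X) \<and> e \<subseteq> K \<union> R"
      using assms(4) by (auto simp: bipartite_graph_def)
  qed
  then have "induced_subgraph (bipartite_graph L R X) (K \<union> R) = bipartite_graph K R X"
    by (intro ugraph.equality) (auto simp: induced_subgraph_def, auto simp: bipartite_graph_def)
  moreover have "vertex_minor (bipartite_graph L R X) (induced_subgraph (bipartite_graph L R X) (K \<union> R))"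
    using assms by (intro vertex_minor_induced_subgraph simple_graph_bipartite_graph)
      (auto simp: bipartite_graph_def)
  ultimately have 2: "vertex_minor (bipartite_graph L R X) ?G"
    using 1 vertex_minor_trans by metis
  have "simple_graph ?G"
    using 1 disj fin assms(2) simple_graph_vertex_minor simple_graph_bipartite_graph by metis
  then have "vertex_minor ?G (induced_subgraph ?G K)"
    by (intro vertex_minor_induced_subgraph) auto
  moreover have "induced_subgraph ?G K = H"
    using H disj by (intro ugraph.equality)
      (auto simp: induced_subgraph_def bipartite_graph_def simple_graph_def nsets_def)
  ultimately show ?thesis using 2 vertex_minor_trans by metis
qed

text \<open>On the old columns, pivoting adds row \<open>u\<close> to each row \<open>l\<close> with
  \<open>X (l, v)\<close>. The new parity of row \<open>l\<close> on \<open>S\<close> is therefore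
  an old parity on \<open>S\<close> or on \<open>insert v S\<close>.\<close>

lemma rank_condition_pivot:
  assumes "finite K" "L \<inter> R = {}" "u \<in> L - K" "v \<in> K \<inter> R" "X (u, v)" "rank_condition L R X K"
  shows "rank_condition (insert v (L - {u})) (insert u (R - {v})) (pivot u v X) K"
  unfolding rank_condition_def
proof (intro allI impI)
  fix S assume "S \<subseteq> K \<inter> insert u (R - {v})" "S \<noteq> {}"
  then have S: "S \<subseteq> K \<inter> R" "v \<notin> S" "u \<notin> S" "S \<noteq> {}" using assms by auto
  then have finS: "finite S" using assms finite_subset by auto
  define odd_row where "odd_row l S \<longleftrightarrow> odd (card {r \<in> S. X (l, r)})" for l S
  have row: "odd (card {r \<in> S. pivot u v X (l, r)}) \<longleftrightarrow> odd_row l S \<noteq> (X (l, v) \<and> odd_row u S)"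
    if "l \<noteq> v" for l
  proof -
    have "{r \<in> S. pivot u v X (l, r)} =
        (if X (l, v) then sym_diff {r \<in> S. X (l, r)} {r \<in> S. X (u, r)} else {r \<in> S. X (l, r)})"
      using that S by (auto simp: pivot_def split: if_splits)
    then show ?thesis
      unfolding odd_row_def using finS by (cases "X (l, v)") (auto simp: odd_card_sym_diff)
  qed
  have row_insert: "odd_row l (insert v S) \<longleftrightarrow> X (l, v) \<noteq> odd_row l S" for l
  proof -
    have "{r \<in> insert v S. X (l, r)} =
        (if X (l, v) then insert v {r \<in> S. X (l, r)} else {r \<in> S. X (l, r)})" by auto
    then show ?thesis using S finS by (simp add: odd_row_def)
  qed
  \<comment> \<open>Column \<open>v\<close> is added exactly when this makes the parity of row
    \<open>u\<close> even. The row obtained from the old condition is then different from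
    \<open>u\<close> and survives the pivot.\<close>
  define S' where "S' = (if odd_row u S then insert v S else S)"
  have "S' \<subseteq> K \<inter> R" "S' \<noteq> {}" using S assms by (auto simp: S'_def)
  then obtain l where l: "l \<in> L - K" "odd_row l S'"
    using assms(6) unfolding rank_condition_def odd_row_def by blast
  have "l \<noteq> u" using l assms(5) by (auto simp: S'_def row_insert split: if_splits)
  moreover have "l \<noteq> v" using l assms by auto
  ultimately have "l \<in> insert v (L - {u}) - K" "odd (card {r \<in> S. pivot u v X (l, r)})"
    using l by (auto simp: row S'_def row_insert split: if_splits)
  then show "\<exists>l\<in>insert v (L - {u}) - K. odd (card {r \<in> S. pivot u v X (l, r)})" by blast
qed

lemma quadratic_on_linear_comp:
  assumes "quadratic_on W q" "\<And>x. x \<subseteq> V \<Longrightarrow> \<phi> x \<subseteq> W"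
    and "\<And>x y. x \<subseteq> V \<Longrightarrow> y \<subseteq> V \<Longrightarrow> \<phi> (sym_diff x y) = sym_diff (\<phi> x) (\<phi> y)"
  shows "quadratic_on V (\<lambda>x. q (\<phi> x))"
  unfolding quadratic_on_def
proof (intro allI impI)
  fix x y z assume V: "x \<subseteq> V" "y \<subseteq> V" "z \<subseteq> V"
  have "sym_diff y z \<subseteq> V" using V by auto
  then show "q (\<phi> (sym_diff x (sym_diff y z))) =
    (q (\<phi> (sym_diff x y)) \<noteq> (q (\<phi> (sym_diff x z)) \<noteq> (q (\<phi> (sym_diff y z)) \<noteq>
      (q (\<phi> x) \<noteq> (q (\<phi> y) \<noteq> q (\<phi> z))))))"
    unfolding assms(3)[OF V(1) \<open>sym_diff y z \<subseteq> V\<close>] assms(3)[OF V(1,2)] assms(3)[OF V(1,3)]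
      assms(3)[OF V(2,3)]
    using V by (intro quadratic_onD[OF assms(1)] assms(2))
qed

text \<open>A form on \<open>W\<close> after the pivot is pulled back to a form on \<open>V\<close>,
  which has \<open>u\<close> in place of \<open>v\<close>. The map taking old columns to new ones is
  linear and onto, so the pulled-back form is quadratic and nonzero.\<close>

lemma quadric_condition_pivot:
  assumes "finite L" "L \<inter> R = {}" "u \<in> L - K" "v \<in> K \<inter> R" "X (u, v)" "quadric_condition L R X K"
  shows "quadric_condition (insert v (L - {u})) (insert u (R - {v})) (pivot u v X) K"
  unfolding quadric_condition_def
proof (intro allI impI, elim conjE exE)
  fix W q x0
  assume W: "K \<inter> insert v (L - {u}) \<subseteq> W" "W \<subseteq> insert v (L - {u})" "card W = card K"
    and q: "quadratic_on W q" "x0 \<subseteq> W" "q x0"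
  define V where "V = insert u (W - {v})"
  have v: "v \<in> W" and u: "u \<notin> W" and uv: "u \<noteq> v" using W assms by auto
  have finW: "finite W" using W(2) assms(1) finite_subset by auto
  have "card V = Suc (card (W - {v}))"
    unfolding V_def using u finW by (intro card_insert_disjoint) auto
  then have "card V = card W" using v finW by (simp only: card_Suc_Diff1)
  \<comment> \<open>\<open>\<phi>\<close> sends the old column on \<open>V\<close> to the new column
    on \<open>W\<close>. The preimage \<open>y0\<close> of \<open>x0\<close> comes from the same
    formula with \<open>u\<close> and \<open>v\<close> exchanged.\<close>
  define \<phi> where "\<phi> y = {l \<in> W. if l = v then u \<in> y else ((l \<in> y) \<noteq> (X (l, v) \<and> u \<in> y))}" for y
  define y0 where "y0 = {l \<in> V. if l = u then v \<in> x0 else ((l \<in> x0) \<noteq> (X (l, v) \<and> v \<in> x0))}"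
  have "\<phi> y0 = x0" using q(2) v u uv by (auto simp: \<phi>_def y0_def V_def)
  then have y0: "q (\<phi> y0)" "y0 \<subseteq> V" using q by (auto simp: y0_def)
  have "quadratic_on V (\<lambda>y. q (\<phi> y))"
    by (rule quadratic_on_linear_comp[OF q(1)]) (auto simp: \<phi>_def)
  moreover have "K \<inter> L \<subseteq> V" "V \<subseteq> L" "card V = card K"
    using W assms \<open>card V = card W\<close> by (auto simp: V_def)
  ultimately obtain r where r: "r \<in> R - K" "q (\<phi> {l \<in> V. X (l, r)})"
    using assms(6) y0 unfolding quadric_condition_def by blast
  have "\<phi> {l \<in> V. X (l, r)} = {l \<in> W. pivot u v X (l, r)}"
    using r assms W u v uv by (auto simp: \<phi>_def V_def pivot_def)
  then show "\<exists>r\<in>insert u (R - {v}) - K. q {l \<in> W. pivot u v X (l, r)}"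
    using r assms(4) by auto
qed

text \<open>Induction on the number of vertices of \<open>K\<close> on the right. The rank condition
  for a single column \<open>v\<close> yields a pivot row \<open>u\<close> outside \<open>K\<close>,
  and the pivot moves \<open>v\<close> to the left while preserving both conditions.\<close>

lemma vertex_minor_of_conditions:
  assumes "finite L" "finite R" "L \<inter> R = {}" "K \<subseteq> L \<union> R"
    and "rank_condition L R X K" "quadric_condition L R X K"
    and "simple_graph H" "verts H = K"
  shows "vertex_minor (bipartite_graph L R X) H"
  using assms
proof (induction "card (K \<inter> R)" arbitrary: L R X)
  case 0
  then have "K \<subseteq> L" by auto
  then show ?case using 0 by (intro vertex_minor_of_left_set)
next
  case (Suc n)
  then obtain v where v: "v \<in> K \<inter> R" by (metis card.empty ex_in_conv nat.simps(3))
  then have "{v} \<subseteq> K \<inter> R" "{v} \<noteq> {}" by auto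
  then obtain u where u: "u \<in> L - K" "odd (card {r \<in> {v}. X (u, r)})"
    using Suc.prems(5) unfolding rank_condition_def by blast
  have X: "X (u, v)"
  proof (rule ccontr)
    assume "\<not> X (u, v)"
    then have "{r \<in> {v}. X (u, r)} = {}" by auto
    then show False using u(2) by (metis card.empty even_zero)
  qed
  let ?L = "insert v (L - {u})" and ?R = "insert u (R - {v})" and ?X = "pivot u v X"
  have finK: "finite K" using Suc.prems finite_subset by auto
  have "K \<inter> ?R = K \<inter> R - {v}" using u by auto
  then have "n = card (K \<inter> ?R)" using Suc.hyps(2) v finK by simp
  moreover have "?L \<inter> ?R = {}" "K \<subseteq> ?L \<union> ?R" using u v Suc.prems(3,4) by auto
  ultimately have "vertex_minor (bipartite_graph ?L ?R ?X) H"
    using Suc.prems u v X finK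
    by (intro Suc.hyps(1) rank_condition_pivot quadric_condition_pivot) auto
  then show ?case
    using vertex_minor_pivot[where X = X] Suc.prems(3) u v X vertex_minor_trans by (metis Diff_iff Int_iff)
qed

subsection \<open>Counting quadratic functions and their zeros\<close>

lemma quadratic_on_empty: "quadratic_on W q \<Longrightarrow> \<not> q {}"
  using quadratic_onD[of W q "{}" "{}" "{}"] by simp

text \<open>A polynomial of degree at most 2 without constant term is determined by its values on
  singletons and pairs: the third-difference identity for \<open>{a}\<close>, \<open>{b}\<close> and
  the rest \<open>z\<close> expresses \<open>q x\<close> through smaller sets.\<close>

lemma quadratic_on_eqI:
  assumes "quadratic_on W q" "quadratic_on W q'" "finite W"
    and "\<And>x. x \<subseteq> W \<Longrightarrow> card x = 1 \<or> card x = 2 \<Longrightarrow> q x = q' x"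
  shows "x \<subseteq> W \<Longrightarrow> q x = q' x"
proof (induction "card x" arbitrary: x rule: less_induct)
  case less
  have fin: "finite x" using less.prems assms(3) finite_subset by auto
  consider "card x = 0" | "card x = 1 \<or> card x = 2" | "card x \<ge> 3" by linarith
  then show ?case
  proof cases
    case 1
    then have "x = {}" using fin by simp
    then show ?thesis using quadratic_on_empty[OF assms(1)] quadratic_on_empty[OF assms(2)] by simp
  next
    case 2
    then show ?thesis using assms(4) less.prems by blast
  next
    case 3
    obtain T where T: "T \<subseteq> x" "card T = 2" using 3 obtain_subset_with_card_n[of 2 x] by auto
    then obtain a b where ab: "T = {a, b}" "a \<noteq> b" by (auto simp: card_2_iff)
    define z where "z = x - {a, b}"
    have z: "a \<notin> z" "b \<notin> z" "x = insert a (insert b z)" "finite z"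
      using T ab fin by (auto simp: z_def)
    have cx: "card x = Suc (Suc (card z))" using z ab by simp
    \<comment> \<open>Nonemptiness of \<open>z\<close> makes \<open>{a, b}\<close> smaller than
      \<open>x\<close>, as the induction hypothesis requires.\<close>
    have cz: "card z \<ge> 1" using cx 3 by linarith
    have d: "sym_diff {a} (sym_diff {b} z) = x" "sym_diff {a} {b} = {a, b}"
      "sym_diff {a} z = insert a z" "sym_diff {b} z = insert b z"
      using z ab by auto
    have sub: "{a} \<subseteq> W" "{b} \<subseteq> W" "z \<subseteq> W" using less.prems z by auto
    have IH: "q y = q' y" if "y \<in> {{a, b}, insert a z, insert b z, {a}, {b}, z}" for y
      using that sub cx cz z ab by (intro less.hyps) auto
    have "q x = (q {a, b} \<noteq> (q (insert a z) \<noteq> (q (insert b z) \<noteq> (q {a} \<noteq> (q {b} \<noteq> q z)))))"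
      using quadratic_onD[OF assms(1) sub] unfolding d(1) unfolding d(2-4) .
    moreover have "q' x = (q' {a, b} \<noteq> (q' (insert a z) \<noteq> (q' (insert b z) \<noteq> (q' {a} \<noteq> (q' {b} \<noteq> q' z)))))"
      using quadratic_onD[OF assms(2) sub] unfolding d(1) unfolding d(2-4) .
    ultimately show ?thesis by (simp add: IH)
  qed
qed

text \<open>Forms are encoded by their sets of ones inside \<open>Pow W\<close>. This identifies
  predicates that differ only off \<open>Pow W\<close> and leaves a finite family for the union
  bound.\<close>

definition quadrics :: "'a set \<Rightarrow> 'a set set set" where
  "quadrics W = {\<Q> \<in> Pow (Pow W). quadratic_on W (\<lambda>x. x \<in> \<Q>)}"

lemma finite_quadrics: "finite W \<Longrightarrow> finite (quadrics W)"
  by (simp add: quadrics_def)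

lemma card_quadrics_le:
  assumes "finite W"
  shows "card (quadrics W) \<le> 2 ^ (card W + (card W choose 2))"
proof -
  let ?B = "nsets W 1 \<union> nsets W 2"
  have finB: "finite ?B" using assms by (simp add: finite_imp_finite_nsets)
  have "inj_on (\<lambda>\<Q>. \<Q> \<inter> ?B) (quadrics W)"
  proof (rule inj_onI)
    fix \<Q> \<Q>' assume Q: "\<Q> \<in> quadrics W" "\<Q>' \<in> quadrics W" and eq: "\<Q> \<inter> ?B = \<Q>' \<inter> ?B"
    have "x \<in> \<Q> \<longleftrightarrow> x \<in> \<Q>'" if "x \<subseteq> W" for x
    proof (rule quadratic_on_eqI[OF _ _ assms _ that])
      show "y \<in> \<Q> \<longleftrightarrow> y \<in> \<Q>'" if "y \<subseteq> W" "card y = 1 \<or> card y = 2" for y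
      proof -
        have "y \<in> ?B" using that assms finite_subset by (auto simp: nsets_def)
        then show ?thesis using eq by blast
      qed
    qed (use Q in \<open>auto simp: quadrics_def\<close>)
    then show "\<Q> = \<Q>'" using Q by (auto simp: quadrics_def)
  qed
  then have "card (quadrics W) \<le> card (Pow ?B)"
    using finB by (intro card_inj_on_le) auto
  also have "\<dots> = 2 ^ card ?B" using finB by (rule card_Pow)
  also have "card ?B = card W + (card W choose 2)"
    using assms by (subst card_Un_disjoint) (auto simp: finite_imp_finite_nsets, auto simp: nsets_def)
  finally show ?thesis .
qed

lemma card_sym_diff_image: "card ((\<lambda>x. sym_diff x u) ` A) = card A"
proof (rule card_image, rule inj_onI)
  fix x y assume "sym_diff x u = sym_diff y u"
  then show "x = y" by blast
qed

text \<open>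
  If some second difference \<open>q (u + v) + q u + q v\<close> is 1, then \<open>q\<close> sums to 1 over every coset
  \<open>{x, x + u, x + v, x + u + v}\<close>, so each coset contains a point where \<open>q\<close> holds; otherwise \<open>q\<close>
  is linear and half of the points do.
\<close>

lemma card_quadratic_zeros_le:
  assumes "quadratic_on W q" "finite W" "x0 \<subseteq> W" "q x0"
  shows "4 * card {x \<in> Pow W. \<not> q x} \<le> 3 * 2 ^ card W"
proof -
  have "\<exists>u v. u \<subseteq> W \<and> v \<subseteq> W \<and>
      (\<forall>x\<subseteq>W. q x \<or> q (sym_diff x u) \<or> q (sym_diff x v) \<or> q (sym_diff (sym_diff x u) v))"
  proof (cases "\<exists>u v. u \<subseteq> W \<and> v \<subseteq> W \<and> (q (sym_diff u v) \<noteq> (q u \<noteq> q v))")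
    case True
    then obtain u v where uv: "u \<subseteq> W" "v \<subseteq> W" "q (sym_diff u v) \<noteq> (q u \<noteq> q v)" by blast
    have "q x \<or> q (sym_diff x u) \<or> q (sym_diff x v) \<or> q (sym_diff (sym_diff x u) v)" if "x \<subseteq> W" for x
    proof -
      have eq: "sym_diff (sym_diff x u) v = sym_diff x (sym_diff u v)" by auto
      show ?thesis
        unfolding eq using quadratic_onD[OF assms(1) that uv(1,2)] uv(3) by argo
    qed
    then show ?thesis using uv(1,2) by blast
  next
    case False
    then have "q x \<or> q (sym_diff x x0)" if "x \<subseteq> W" for x using that assms(3,4) by blast
    then show ?thesis using assms(3) by blast
  qed
  then obtain u v where uv: "u \<subseteq> W" "v \<subseteq> W"
      "\<And>x. x \<subseteq> W \<Longrightarrow> q x \<or> q (sym_diff x u) \<or> q (sym_diff x v) \<or> q (sym_diff (sym_diff x u) v)"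
    by blast
  let ?A = "{x \<in> Pow W. q x}"
  let ?s = "\<lambda>u A. (\<lambda>x. sym_diff x u) ` A"
  have finA: "finite ?A" using assms(2) by simp
  have inv: "x \<in> ?s u B" if "sym_diff x u \<in> B" for x u and B :: "'a set set"
    using that by (intro image_eqI[of _ _ "sym_diff x u"]) auto
  \<comment> \<open>The set of ones and three translates of it cover the space. Translations
    preserve cardinality, so at least a quarter of the points are ones.\<close>
  have "Pow W \<subseteq> ?A \<union> ?s u ?A \<union> ?s v ?A \<union> ?s u (?s v ?A)"
  proof
    fix x assume x: "x \<in> Pow W"
    then have "sym_diff x u \<in> Pow W" "sym_diff x v \<in> Pow W" "sym_diff (sym_diff x u) v \<in> Pow W"
      using uv(1,2) by auto
    then have "x \<in> ?A \<or> sym_diff x u \<in> ?A \<or> sym_diff x v \<in> ?A \<or> sym_diff (sym_diff x u) v \<in> ?A"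
      using uv(3)[of x] x by auto
    then show "x \<in> ?A \<union> ?s u ?A \<union> ?s v ?A \<union> ?s u (?s v ?A)"
      using inv by (metis (no_types, lifting) UnCI)
  qed
  then have "card (Pow W) \<le> card (?A \<union> ?s u ?A \<union> ?s v ?A \<union> ?s u (?s v ?A))"
    using finA by (intro card_mono) auto
  also have "\<dots> \<le> card ?A + card (?s u ?A) + card (?s v ?A) + card (?s u (?s v ?A))"
    by (meson add_mono card_Un_le order_trans order_refl)
  also have "\<dots> = 4 * card ?A" by (simp only: card_sym_diff_image)
  finally have "2 ^ card W \<le> 4 * card ?A" using assms(2) by (simp add: card_Pow)
  moreover have "card {x \<in> Pow W. \<not> q x} = card (Pow W - ?A)"
    by (rule arg_cong[of _ _ card]) auto
  then have "card {x \<in> Pow W. \<not> q x} = 2 ^ card W - card ?A"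
    using assms(2) finA by (subst (asm) card_Diff_subset) (auto simp: card_Pow)
  ultimately show ?thesis by linarith
qed

text \<open>Toggling a fixed element \<open>s\<close> injects the even subsets into the odd
  ones.\<close>

lemma card_even_subsets_le:
  assumes "finite S" "S \<noteq> {}"
  shows "2 * card {x \<in> Pow S. even (card x)} \<le> 2 ^ card S"
proof -
  obtain s where s: "s \<in> S" using assms by auto
  let ?A = "{x \<in> Pow S. even (card x)}" and ?B = "{x \<in> Pow S. odd (card x)}"
  have "(\<lambda>x. sym_diff x {s}) ` ?A \<subseteq> ?B"
  proof (rule image_subsetI)
    fix x assume x: "x \<in> ?A"
    then have "finite x" using assms finite_subset by auto
    then have "odd (card (sym_diff x {s}))" using x odd_card_sym_diff[of x "{s}"] by simp
    then show "sym_diff x {s} \<in> ?B" using x s by auto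
  qed
  then have "card ((\<lambda>x. sym_diff x {s}) ` ?A) \<le> card ?B"
    using assms(1) by (intro card_mono) auto
  then have "card ?A \<le> card ?B" by (simp only: card_sym_diff_image)
  moreover have "card ?A + card ?B = card (?A \<union> ?B)"
    using assms(1) by (intro card_Un_disjoint[symmetric]) auto
  moreover have "?A \<union> ?B = Pow S" by auto
  ultimately show ?thesis using assms(1) by (simp add: card_Pow)
qed

subsection \<open>Failure probability\<close>

text \<open>Events depending on disjoint blocks of coordinates are independent. The induction splits
  off one block; \<open>I\<close> is generalized because the remaining coordinates are
  \<open>I - B j\<close>.\<close>

lemma prob_Pi_pmf_blocks_le:
  fixes B :: "'j \<Rightarrow> 'i set" and E :: "'j \<Rightarrow> ('i \<Rightarrow> 'b) \<Rightarrow> bool"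
  assumes "finite J" "finite I" "\<And>j. j \<in> J \<Longrightarrow> B j \<subseteq> I" "disjoint_family_on B J"
    and local: "\<And>j f g. j \<in> J \<Longrightarrow> (\<And>i. i \<in> B j \<Longrightarrow> f i = g i) \<Longrightarrow> E j f \<longleftrightarrow> E j g"
    and le: "\<And>j. j \<in> J \<Longrightarrow> measure_pmf.prob (Pi_pmf (B j) d p) {f. E j f} \<le> c"
  shows "measure_pmf.prob (Pi_pmf I d p) {f. \<forall>j\<in>J. E j f} \<le> c ^ card J"
  using assms
proof (induction J arbitrary: I)
  case empty
  then show ?case by simp
next
  case (insert j J)
  let ?M = "Pi_pmf (B j) d p" and ?N = "Pi_pmf (I - B j) d p"
  let ?A = "{f. E j f}" and ?A' = "{f. \<forall>j\<in>J. E j f}"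
  let ?h = "\<lambda>(f, g) x. if x \<in> B j then f x else g x"
  have fin: "finite (B j)" using insert.prems(1,2) finite_subset by blast
  have "Pi_pmf (B j \<union> (I - B j)) d p = map_pmf ?h (pair_pmf ?M ?N)"
    using fin insert.prems(1) by (intro Pi_pmf_union) auto
  moreover have "B j \<union> (I - B j) = I" using insert.prems(2) by auto
  moreover have "?h (f, g) \<in> {f. \<forall>j\<in>insert j J. E j f} \<longleftrightarrow> f \<in> ?A \<and> g \<in> ?A'" for f g
  proof -
    have "E j (?h (f, g)) \<longleftrightarrow> E j f" by (rule insert.prems(4)) auto
    moreover have "E i (?h (f, g)) \<longleftrightarrow> E i g" if "i \<in> J" for i
    proof -
      have "B i \<inter> B j = {}"
        using insert.prems(3) insert.hyps that by (auto simp: disjoint_family_on_def)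
      then have "?h (f, g) x = g x" if "x \<in> B i" for x using that by auto
      then show ?thesis by (intro insert.prems(4)) (use that in auto)
    qed
    ultimately show ?thesis by simp
  qed
  then have "?h -` {f. \<forall>j\<in>insert j J. E j f} = ?A \<times> ?A'" by auto
  ultimately have "measure_pmf.prob (Pi_pmf I d p) {f. \<forall>j\<in>insert j J. E j f} =
      measure_pmf.prob (pair_pmf ?M ?N) (?A \<times> ?A')"
    by simp
  \<comment> \<open>Intersecting with the supports makes both factors countable, as the product rule
    used next demands.\<close>
  also have "\<dots> = measure_pmf.prob (pair_pmf ?M ?N) ((?A \<inter> set_pmf ?M) \<times> (?A' \<inter> set_pmf ?N))"
    by (subst (1 2) measure_Int_set_pmf[symmetric]) (rule arg_cong, auto)
  also have "\<dots> = measure_pmf.prob ?M ?A * measure_pmf.prob ?N ?A'"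
    by (subst measure_pmf_prob_product) (auto simp: measure_Int_set_pmf)
  also have "\<dots> \<le> c * c ^ card J"
  proof (rule mult_mono)
    show "measure_pmf.prob ?M ?A \<le> c" using insert.prems(5) by simp
    then show "0 \<le> c" using measure_nonneg order_trans by blast
    show "measure_pmf.prob ?N ?A' \<le> c ^ card J"
    proof (rule insert.IH)
      show "B i \<subseteq> I - B j" if "i \<in> J" for i
        using insert.prems(2,3) insert.hyps that by (fastforce simp: disjoint_family_on_def)
      show "disjoint_family_on B J"
        using insert.prems(3) by (auto simp: disjoint_family_on_def)
      show "E i f \<longleftrightarrow> E i g" if "i \<in> J" "\<And>x. x \<in> B i \<Longrightarrow> f x = g x" for i f g
        by (rule insert.prems(4)) (use that in auto)
      show "finite (I - B j)" using insert.prems(1) by simp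
      show "measure_pmf.prob (Pi_pmf (B i) d p) {f. E i f} \<le> c" if "i \<in> J" for i
        by (rule insert.prems(5)) (use that in simp)
    qed
  qed simp
  finally show ?case using insert.hyps by simp
qed

text \<open>The coins showing true form a uniformly random subset of \<open>B\<close>, which
  \<open>h\<close> pulls back to one of \<open>S\<close>, so probabilities become counts. Later
  \<open>h\<close> pairs an element with a fixed row or column.\<close>

lemma prob_Pi_pmf_bernoulli_half:
  assumes "finite S" "bij_betw h S B"
  shows "measure_pmf.prob (Pi_pmf B d (\<lambda>_. bernoulli_pmf (1 / 2))) {f. P {x \<in> S. f (h x)}} =
    real (card {x \<in> Pow S. P x}) / 2 ^ card S"
proof -
  have B: "finite B" "card B = card S" "h ` S = B" "inj_on h S"
    using assms bij_betw_finite bij_betw_same_card by (auto simp: bij_betw_def card_image)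
  let ?Y = "{y. P {x \<in> S. h x \<in> y}}"
  have "{x \<in> S. h x \<in> {i \<in> B. f i}} = {x \<in> S. f (h x)}" for f
    using B(3) by auto
  then have "{f. P {x \<in> S. f (h x)}} = (\<lambda>b. {i \<in> B. b i}) -` ?Y"
    by simp
  then have "measure_pmf.prob (Pi_pmf B d (\<lambda>_. bernoulli_pmf (1 / 2))) {f. P {x \<in> S. f (h x)}} =
      measure_pmf.prob (pmf_of_set (Pow B)) ?Y"
    using B(1) by (simp flip: pmf_of_set_Pow_conv_bernoulli[where P = d])
  also have "\<dots> = real (card (Pow B \<inter> ?Y)) / 2 ^ card S"
    using B by (subst measure_pmf_of_set) (auto simp: card_Pow)
  also have "Pow B \<inter> ?Y = (`) h ` {x \<in> Pow S. P x}"
  proof -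
    have *: "{x \<in> S. h x \<in> h ` y} = y" if "y \<subseteq> S" for y
      using that B(4) by (auto simp: inj_on_def)
    show ?thesis
    proof (intro equalityI subsetI)
      fix Y assume Y: "Y \<in> Pow B \<inter> ?Y"
      then obtain y where y: "y \<subseteq> S" "Y = h ` y" using B(3) by (auto simp: subset_image_iff)
      then show "Y \<in> (`) h ` {x \<in> Pow S. P x}" using Y *[OF y(1)] by auto
    next
      fix Y assume "Y \<in> (`) h ` {x \<in> Pow S. P x}"
      then obtain y where "y \<subseteq> S" "P y" "Y = h ` y" by auto
      then show "Y \<in> Pow B \<inter> ?Y" using *[of y] B(3) by auto
    qed
  qed
  also have "card \<dots> = card {x \<in> Pow S. P x}"
    using B(4) by (intro card_image inj_on_subset[OF inj_on_image_Pow]) auto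
  finally show ?thesis .
qed

abbreviation fair_coins :: "'i set \<Rightarrow> ('i \<Rightarrow> bool) pmf" where
  "fair_coins I \<equiv> Pi_pmf I False (\<lambda>_. bernoulli_pmf (1 / 2))"

text \<open>For fixed \<open>S\<close> the rows outside \<open>K\<close> are independent, and each
  has even parity on \<open>S\<close> with probability at most 1/2.\<close>

lemma prob_rank_defect_le:
  fixes L R :: "'a set"
  assumes "finite L" "finite R" "finite K" "S \<subseteq> R" "S \<noteq> {}"
  shows "measure_pmf.prob (fair_coins (L \<times> R)) {X. \<forall>l\<in>L - K. even (card {r \<in> S. X (l, r)})}
    \<le> (1 / 2) ^ (card L - card K)"
proof -
  have S: "finite S" using assms finite_subset by auto
  have "measure_pmf.prob (fair_coins (L \<times> R)) {X. \<forall>l\<in>L - K. even (card {r \<in> S. X (l, r)})}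
      \<le> (1 / 2) ^ card (L - K)"
  proof (rule prob_Pi_pmf_blocks_le[where B = "\<lambda>l. {l} \<times> S"])
    show "disjoint_family_on (\<lambda>l. {l} \<times> S) (L - K)" by (auto simp: disjoint_family_on_def)
    show "even (card {r \<in> S. f (l, r)}) \<longleftrightarrow> even (card {r \<in> S. g (l, r)})"
      if "\<And>i. i \<in> {l} \<times> S \<Longrightarrow> f i = g i" for l and f g :: "'a \<times> 'a \<Rightarrow> bool"
    proof -
      have "{r \<in> S. f (l, r)} = {r \<in> S. g (l, r)}" using that by auto
      then show ?thesis by simp
    qed
    show "measure_pmf.prob (fair_coins ({l} \<times> S)) {X. even (card {r \<in> S. X (l, r)})} \<le> 1 / 2" for l
    proof -
      have "real (2 * card {x \<in> Pow S. even (card x)}) \<le> real (2 ^ card S)"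
        using card_even_subsets_le[OF S assms(5)] by (simp only: of_nat_le_iff)
      moreover have bij: "bij_betw (Pair l) S ({l} \<times> S)" by (auto simp: bij_betw_def inj_on_def)
      ultimately show ?thesis
        unfolding prob_Pi_pmf_bernoulli_half[OF S bij, of False "\<lambda>x. even (card x)"]
        by (simp add: field_simps)
    qed
  qed (use assms in auto)
  also have "\<dots> \<le> (1 / 2) ^ (card L - card K)"
    using assms by (intro power_decreasing diff_card_le_card_Diff) auto
  finally show ?thesis .
qed

text \<open>The columns outside \<open>K\<close> restricted to \<open>W\<close> are independent
  uniform subsets of \<open>W\<close>, each a zero of \<open>q\<close> with probability at most
  3/4.\<close>

lemma prob_quadric_defect_le:
  fixes L R :: "'a set"
  assumes "finite L" "finite R" "finite K" "W \<subseteq> L" "quadratic_on W q" "x0 \<subseteq> W" "q x0"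
  shows "measure_pmf.prob (fair_coins (L \<times> R)) {X. \<forall>r\<in>R - K. \<not> q {l \<in> W. X (l, r)}}
    \<le> (3 / 4) ^ (card R - card K)"
proof -
  have W: "finite W" using assms finite_subset by auto
  have "measure_pmf.prob (fair_coins (L \<times> R)) {X. \<forall>r\<in>R - K. \<not> q {l \<in> W. X (l, r)}}
      \<le> (3 / 4) ^ card (R - K)"
  proof (rule prob_Pi_pmf_blocks_le[where B = "\<lambda>r. W \<times> {r}"])
    show "disjoint_family_on (\<lambda>r. W \<times> {r}) (R - K)" by (auto simp: disjoint_family_on_def)
    show "(\<not> q {l \<in> W. f (l, r)}) \<longleftrightarrow> (\<not> q {l \<in> W. g (l, r)})"
      if "\<And>i. i \<in> W \<times> {r} \<Longrightarrow> f i = g i" for r and f g :: "'a \<times> 'a \<Rightarrow> bool"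
    proof -
      have "{l \<in> W. f (l, r)} = {l \<in> W. g (l, r)}" using that by auto
      then show ?thesis by simp
    qed
    show "measure_pmf.prob (fair_coins (W \<times> {r})) {X. \<not> q {l \<in> W. X (l, r)}} \<le> 3 / 4" for r
    proof -
      have "real (4 * card {x \<in> Pow W. \<not> q x}) \<le> real (3 * 2 ^ card W)"
        using card_quadratic_zeros_le[OF assms(5) W assms(6,7)] by (simp only: of_nat_le_iff)
      moreover have bij: "bij_betw (\<lambda>l. (l, r)) W (W \<times> {r})" by (auto simp: bij_betw_def inj_on_def)
      ultimately show ?thesis
        unfolding prob_Pi_pmf_bernoulli_half[OF W bij, of False "\<lambda>x. \<not> q x"]
        by (simp add: field_simps)
    qed
  qed (use assms in auto)
  also have "\<dots> \<le> (3 / 4) ^ (card R - card K)"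
    using assms by (intro power_decreasing diff_card_le_card_Diff) auto
  finally show ?thesis .
qed

lemma prob_UN_le_card:
  fixes A :: "'b \<Rightarrow> 'c set"
  assumes "finite I" "\<And>i. i \<in> I \<Longrightarrow> measure_pmf.prob p (A i) \<le> b"
  shows "measure_pmf.prob p (\<Union>i\<in>I. A i) \<le> real (card I) * b"
proof -
  have "measure_pmf.prob p (\<Union>i\<in>I. A i) \<le> (\<Sum>i\<in>I. measure_pmf.prob p (A i))"
    using assms(1) by (intro measure_UNION_le) auto
  also have "\<dots> \<le> real (card I) * b" using assms by (intro sum_bounded_above)
  finally show ?thesis .
qed

lemma prob_not_rank_condition_le:
  assumes "finite L" "finite R" "finite K"
  shows "measure_pmf.prob (fair_coins (L \<times> R)) {X. \<not> rank_condition L R X K}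
    \<le> 2 ^ card K * (1 / 2) ^ (card L - card K)"
proof -
  let ?I = "Pow (K \<inter> R) - {{}}"
  have "{X. \<not> rank_condition L R X K} = (\<Union>S\<in>?I. {X. \<forall>l\<in>L - K. even (card {r \<in> S. X (l, r)})})"
    by (auto simp: rank_condition_def)
  then have "measure_pmf.prob (fair_coins (L \<times> R)) {X. \<not> rank_condition L R X K}
      \<le> real (card ?I) * (1 / 2) ^ (card L - card K)"
    using assms by (simp only:) (intro prob_UN_le_card prob_rank_defect_le, auto)
  also have "\<dots> \<le> 2 ^ card K * (1 / 2) ^ (card L - card K)"
  proof (intro mult_right_mono)
    have "card ?I \<le> card (Pow K)" using assms by (intro card_mono) auto
    then have "card ?I \<le> 2 ^ card K" using assms by (simp add: card_Pow)
    then show "real (card ?I) \<le> 2 ^ card K" by (metis of_nat_le_iff of_nat_numeral of_nat_power)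
  qed simp
  finally show ?thesis .
qed

text \<open>Union bound over the sets \<open>W\<close>, giving the binomial factor, and over the
  nonzero forms on each \<open>W\<close>, giving the power of 2.\<close>

lemma prob_not_quadric_condition_le:
  assumes "finite L" "finite R" "finite K"
  shows "measure_pmf.prob (fair_coins (L \<times> R)) {X. \<not> quadric_condition L R X K}
    \<le> real (card L choose card K) * 2 ^ (card K + (card K choose 2)) * (3 / 4) ^ (card R - card K)"
proof -
  let ?p = "fair_coins (L \<times> R)" and ?b = "(3 / 4 :: real) ^ (card R - card K)"
  let ?Q = "\<lambda>W. quadrics W - {{}}"
  let ?A = "\<lambda>W \<Q>. {X. \<forall>r\<in>R - K. {l \<in> W. X (l, r)} \<notin> \<Q>}"
  have "{X. \<not> quadric_condition L R X K} \<subseteq> (\<Union>W\<in>nsets L (card K). \<Union>\<Q>\<in>?Q W. ?A W \<Q>)"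
  proof
    fix X assume "X \<in> {X. \<not> quadric_condition L R X K}"
    then obtain W q x0 where W: "W \<subseteq> L" "card W = card K" and q: "quadratic_on W q" "x0 \<subseteq> W" "q x0"
      and X: "\<And>r. r \<in> R - K \<Longrightarrow> \<not> q {l \<in> W. X (l, r)}"
      unfolding quadric_condition_def by blast
    let ?T = "{x \<in> Pow W. q x}"
    have "sym_diff x y \<subseteq> W" if "x \<subseteq> W" "y \<subseteq> W" for x y using that by auto
    then have "quadratic_on W (\<lambda>x. x \<in> ?T)"
      using q(1) unfolding quadratic_on_def by simp
    then have "?T \<in> ?Q W" using q by (auto simp: quadrics_def)
    moreover have "X \<in> ?A W ?T" using X by auto
    moreover have "W \<in> nsets L (card K)" using W assms(1) finite_subset by (auto simp: nsets_def)
    ultimately show "X \<in> (\<Union>W\<in>nsets L (card K). \<Union>\<Q>\<in>?Q W. ?A W \<Q>)" by blast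
  qed
  then have "measure_pmf.prob ?p {X. \<not> quadric_condition L R X K} \<le>
      measure_pmf.prob ?p (\<Union>W\<in>nsets L (card K). \<Union>\<Q>\<in>?Q W. ?A W \<Q>)"
    by (intro measure_pmf.finite_measure_mono) auto
  also have "\<dots> \<le> real (card (nsets L (card K))) * (2 ^ (card K + (card K choose 2)) * ?b)"
  proof (rule prob_UN_le_card)
    show "finite (nsets L (card K))" using assms by (simp add: finite_imp_finite_nsets)
    fix W assume "W \<in> nsets L (card K)"
    then have W: "W \<subseteq> L" "finite W" "card W = card K" by (auto simp: nsets_def)
    have "measure_pmf.prob ?p (\<Union>\<Q>\<in>?Q W. ?A W \<Q>) \<le> real (card (?Q W)) * ?b"
    proof (rule prob_UN_le_card)
      show "finite (?Q W)" using W finite_quadrics by auto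
      fix \<Q> assume Q: "\<Q> \<in> ?Q W"
      then obtain x0 where "x0 \<in> \<Q>" by auto
      then show "measure_pmf.prob ?p (?A W \<Q>) \<le> ?b"
        using assms W Q by (intro prob_quadric_defect_le[of L R K W _ x0]) (auto simp: quadrics_def)
    qed
    also have "\<dots> \<le> 2 ^ (card K + (card K choose 2)) * ?b"
    proof (intro mult_right_mono)
      have "card (?Q W) \<le> card (quadrics W)" using W finite_quadrics by (intro card_mono) auto
      then have "card (?Q W) \<le> 2 ^ (card K + (card K choose 2))"
        using card_quadrics_le[of W] W by simp
      then show "real (card (?Q W)) \<le> 2 ^ (card K + (card K choose 2))"
        by (metis of_nat_le_iff of_nat_numeral of_nat_power)
    qed simp
    finally show "measure_pmf.prob ?p (\<Union>\<Q>\<in>?Q W. ?A W \<Q>) \<le> 2 ^ (card K + (card K choose 2)) * ?b" .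
  qed
  finally show ?thesis by (simp add: mult.assoc)
qed

lemma prob_vertex_minor_universal_ge:
  fixes L R :: "'a set"
  assumes "finite L" "finite R" "L \<inter> R = {}" "k \<le> card L + card R"
  shows "measure_pmf.prob (random_bipartite_graph L R) {G. vertex_minor_universal k G} \<ge>
    1 - real ((card L + card R) choose k) * (2 ^ k * (1 / 2) ^ (card L - k) +
      real (card L choose k) * 2 ^ (k + (k choose 2)) * (3 / 4) ^ (card R - k))"
proof -
  let ?p = "fair_coins (L \<times> R)"
  let ?B = "\<lambda>K. {X. \<not> rank_condition L R X K} \<union> {X. \<not> quadric_condition L R X K}"
  let ?b = "2 ^ k * (1 / 2) ^ (card L - k) +
      real (card L choose k) * 2 ^ (k + (k choose 2)) * (3 / 4) ^ (card R - k)"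
  let ?U = "bipartite_graph L R -` {G. vertex_minor_universal k G}"
  have card: "card (L \<union> R) = card L + card R" using assms(1-3) by (rule card_Un_disjoint)
  have "UNIV - ?U \<subseteq> (\<Union>K\<in>nsets (L \<union> R) k. ?B K)"
  proof
    fix X assume "X \<in> UNIV - ?U"
    then obtain K H where K: "K \<subseteq> L \<union> R" "card K = k" and H: "simple_graph H" "verts H = K"
      and not: "\<not> vertex_minor (bipartite_graph L R X) H"
      using assms(4) card by (auto simp: vertex_minor_universal_def bipartite_graph_def)
    have "finite K" using K assms finite_subset by auto
    then have "K \<in> nsets (L \<union> R) k" using K by (simp add: nsets_def)
    moreover have "X \<in> ?B K" using vertex_minor_of_conditions[OF assms(1-3) K(1) _ _ H] not by blast
    ultimately show "X \<in> (\<Union>K\<in>nsets (L \<union> R) k. ?B K)" by blast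
  qed
  then have "measure_pmf.prob ?p (UNIV - ?U) \<le> measure_pmf.prob ?p (\<Union>K\<in>nsets (L \<union> R) k. ?B K)"
    by (intro measure_pmf.finite_measure_mono) auto
  also have "\<dots> \<le> real (card (nsets (L \<union> R) k)) * ?b"
  proof (rule prob_UN_le_card)
    show "finite (nsets (L \<union> R) k)" using assms by (simp add: finite_imp_finite_nsets)
    fix K assume "K \<in> nsets (L \<union> R) k"
    then have K: "finite K" "card K = k" by (auto simp: nsets_def)
    have "measure_pmf.prob ?p (?B K) \<le> measure_pmf.prob ?p {X. \<not> rank_condition L R X K} +
        measure_pmf.prob ?p {X. \<not> quadric_condition L R X K}"
      by (intro measure_Un_le) auto
    then show "measure_pmf.prob ?p (?B K) \<le> ?b"
      using prob_not_rank_condition_le[OF assms(1,2) K(1)]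
        prob_not_quadric_condition_le[OF assms(1,2) K(1)] unfolding K(2) by linarith
  qed
  finally have "measure_pmf.prob ?p (UNIV - ?U) \<le> real ((card L + card R) choose k) * ?b"
    by (simp only: card_nsets card)
  moreover have "measure_pmf.prob ?p (UNIV - ?U) = 1 - measure_pmf.prob ?p ?U"
    using measure_pmf.prob_compl[of ?U ?p] by simp
  ultimately show ?thesis by (simp add: random_bipartite_graph_def)
qed

subsection \<open>Asymptotics\<close>

text \<open>\<open>k^k / k!\<close> is a single term of the exponential series at
  \<open>k\<close>.\<close>

lemma power_le_exp_fact: "real k ^ k \<le> exp (real k) * fact k"
proof -
  have "(\<lambda>n. real k ^ n /\<^sub>R fact n) sums exp (real k)" by (rule exp_converges)
  then have "real k ^ k /\<^sub>R fact k \<le> exp (real k)"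
    using sum_le_suminf[of "\<lambda>n. real k ^ n /\<^sub>R fact n" "{k}"] by (auto simp: sums_iff)
  then show ?thesis by (simp add: field_simps)
qed

text \<open>The division by \<open>k\<close> matters: for \<open>n\<close> of order
  \<open>k^2\<close> the exponent is \<open>k ln k + O(k)\<close>, whereas the cruder bound
  \<open>n^k\<close> would give \<open>2 k ln k\<close>, too much for the rank estimate.\<close>

lemma binomial_le_exp:
  assumes "k > 0"
  shows "real (n choose k) \<le> (exp 1 * real n / real k) ^ k"
proof -
  have "real (n choose k) * real k ^ k \<le> real (n choose k) * (exp (real k) * fact k)"
    by (intro mult_left_mono power_le_exp_fact) simp
  also have "\<dots> = real ((n choose k) * fact k) * exp (real k)" by simp
  also have "\<dots> \<le> real (n ^ k) * exp (real k)"
    by (intro mult_right_mono) (use binomial_fact_pow[of n k] in \<open>simp_all only: of_nat_le_iff exp_ge_zero\<close>)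
  finally have "real (n choose k) * real k ^ k \<le> real n ^ k * exp 1 ^ k"
    by (simp add: exp_of_nat_mult[symmetric])
  then show ?thesis using assms by (simp add: field_simps power_mult_distrib power_divide)
qed

lemma binomial_le_power: "n choose k \<le> n ^ k"
  by (metis binomial_eq_0 binomial_le_pow le0 linorder_not_le)


text \<open>Truncated subtraction does no harm, since \<open>m - k\<close> as a natural number is at
  least the real difference and hence at least \<open>b\<close>.\<close>

lemma power_diff_le_exp:
  fixes x b a :: real
  assumes "0 < x" "x \<le> exp (- a)" "a \<ge> 0" "b \<le> real m - real k"
  shows "x ^ (m - k) \<le> exp (- a * b)"
proof -
  have "x ^ (m - k) \<le> exp (- a) ^ (m - k)" using assms by (intro power_mono) auto
  also have "\<dots> = exp (- a * real (m - k))" by (simp add: exp_of_nat_mult[symmetric])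
  also have "\<dots> \<le> exp (- a * b)" using assms by (auto intro: mult_left_mono)
  finally show ?thesis .
qed

text \<open>Exponent of the rank failure. The \<open>k ln k\<close> terms sum to
  \<open>-(d + \<epsilon>) k ln k\<close>, and the slack \<open>d k ln k\<close> absorbs everything
  of order \<open>k\<close>. The final \<open>ln 2\<close> reserves half of the allowed failure
  probability.\<close>

lemma eventually_left_bound:
  fixes d C \<epsilon> :: real
  assumes "d > 0" "C > 0"
  shows "\<forall>\<^sub>F k::nat in sequentially.
    k * (1 + ln (C * k)) + k * ln 2 - (d + 1 + \<epsilon>) * k * ln k + (1 + k) * ln 2 \<le> - \<epsilon> * k * ln k - ln 2"
  using assms by real_asymp

text \<open>Exponent of the quadric failure. The quadratic terms sum to
  \<open>-\<delta> k^2 / 4\<close>, which dominates all terms of order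
  \<open>k ln k\<close>.\<close>

lemma eventually_right_bound:
  fixes \<delta> C \<epsilon> :: real
  assumes "\<delta> > 0" "C > 0"
  shows "\<forall>\<^sub>F k::nat in sequentially.
    2 * k * ln (C * (real k)\<^sup>2) + k + k * (real k - 1) / 2 - ((\<delta> + 2) * (real k)\<^sup>2 - 1 - k) / 4 \<le> - \<epsilon> * k * ln k - ln 2"
  using assms by real_asymp

lemma eventually_failure_bound:
  fixes \<epsilon> c c' :: real
  assumes "\<epsilon> > 0" "c > 2" "c' > (1 + \<epsilon>) / ln 2"
  shows "\<forall>\<^sub>F k in sequentially. \<forall>l r.
    int l = \<lfloor>c' * real k * ln (real k)\<rfloor> \<longrightarrow> int r = \<lfloor>c * (real k)\<^sup>2\<rfloor> \<longrightarrow>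
    k \<le> l + r \<and>
    real ((l + r) choose k) * (2 ^ k * (1 / 2) ^ (l - k) +
      real (l choose k) * 2 ^ (k + (k choose 2)) * (3 / 4) ^ (r - k)) \<le> exp (- \<epsilon> * real k * ln (real k))"
proof -
  \<comment> \<open>\<open>d\<close> and \<open>\<delta>\<close> are the slacks in the assumptions
    on \<open>c'\<close> and \<open>c\<close>; \<open>C\<close> is chosen so that the number of
    vertices is at most \<open>C k^2\<close>.\<close>
  define d where "d = c' * ln 2 - 1 - \<epsilon>"
  define \<delta> where "\<delta> = c - 2"
  define C where "C = c + c'"
  have d: "d > 0" using assms(3) by (simp add: d_def field_simps)
  have c': "c' > 0"
    using assms by (meson add_pos_pos divide_pos_pos less_trans ln_gt_zero one_less_numeral_iff semiring_norm(76) zero_less_one)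
  have \<delta>: "\<delta> > 0" and C: "C > 0" using assms c' by (auto simp: \<delta>_def C_def)
  have "\<forall>\<^sub>F k::nat in sequentially. k \<le> c * (real k)\<^sup>2 - 1" using assms(2) by real_asymp
  then show ?thesis
    using eventually_left_bound[OF d C, of \<epsilon>] eventually_right_bound[OF \<delta> C, of \<epsilon>]
      eventually_gt_at_top[of 0]
  proof eventually_elim
    case (elim k)
    show ?case
    proof (intro allI impI)
      fix l r
      assume l: "int l = \<lfloor>c' * real k * ln (real k)\<rfloor>" and r: "int r = \<lfloor>c * (real k)\<^sup>2\<rfloor>"
      define n where "n = l + r"
      have k: "real k > 0" using elim by simp
      have l': "real l \<le> c' * k * ln k" "c' * k * ln k - 1 \<le> real l"
        using l by linarith+
      have r': "real r \<le> c * (real k)\<^sup>2" "c * (real k)\<^sup>2 - 1 \<le> real r"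
        using r by linarith+
      have "k \<le> n" using elim(1) r' by (simp add: n_def)
      have "ln k \<le> k" using ln_less_self[OF k] by simp
      then have "c' * k * ln k \<le> c' * k * k" using k c' by (intro mult_left_mono) auto
      then have n: "real n \<le> C * (real k)\<^sup>2"
        using l' r' by (simp add: n_def C_def algebra_simps power2_eq_square)
      have e: "exp (x) ^ k = exp (real k * x)" for x by (simp add: exp_of_nat_mult)
      have "real (n choose k) \<le> (exp 1 * real n / real k) ^ k"
        using k by (intro binomial_le_exp) simp
      also have "\<dots> \<le> (exp 1 * (C * real k)) ^ k"
        using n k by (intro power_mono) (auto simp: field_simps power2_eq_square)
      also have "exp 1 * (C * real k) = exp (1 + ln (C * real k))"
        using k C by (simp add: exp_add)
      also have "\<dots> ^ k = exp (k * (1 + ln (C * k)))" by (rule e)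
      finally have b1: "real (n choose k) \<le> exp (k * (1 + ln (C * k)))" .
      have "m choose k \<le> exp (k * ln (C * (real k)\<^sup>2))" if "m \<le> n" for m
      proof -
        have "real (m choose k) \<le> real m ^ k"
          using binomial_le_power[of m k] by (metis of_nat_le_iff of_nat_power)
        also have "\<dots> \<le> (C * (real k)\<^sup>2) ^ k" using n that by (intro power_mono) auto
        also have "C * (real k)\<^sup>2 = exp (ln (C * (real k)\<^sup>2))" using k C by simp
        also have "\<dots> ^ k = exp (k * ln (C * (real k)\<^sup>2))" by (rule e)
        finally show ?thesis .
      qed
      then have b2: "n choose k \<le> exp (k * ln (C * (real k)\<^sup>2))" "l choose k \<le> exp (k * ln (C * (real k)\<^sup>2))"
        by (auto simp: n_def)
      \<comment> \<open>In the exponent, 1 is lost to rounding down and \<open>k\<close> to the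
        vertices of \<open>K\<close>.\<close>
      have p1: "(1 / 2 :: real) ^ (l - k) \<le> exp (- ln 2 * (c' * k * ln k - 1 - k))"
        by (intro power_diff_le_exp) (use l' in \<open>auto simp: exp_minus\<close>)
      \<comment> \<open>With the estimates \<open>3/4 \<le> exp (-1/4)\<close> and
        \<open>2 \<le> exp 1\<close>, the number of forms contributes \<open>k^2 / 2\<close> and the
        columns \<open>-c k^2 / 4\<close>; the sum is negative exactly when
        \<open>c > 2\<close>.\<close>
      have "(3 / 4 :: real) \<le> exp (- (1 / 4))" using exp_ge_add_one_self[of "- (1 / 4) :: real"] by simp
      then have p2: "(3 / 4 :: real) ^ (r - k) \<le> exp (- (1 / 4) * (c * (real k)\<^sup>2 - 1 - k))"
        by (intro power_diff_le_exp) (use r' in auto)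
      have p3: "(2 :: real) ^ k = exp (k * ln 2)" by (simp add: exp_of_nat_mult)
      have "(2 :: real) \<le> exp 1" using exp_ge_add_one_self[of 1] by simp
      then have "(2 :: real) ^ (k + (k choose 2)) \<le> exp 1 ^ (k + (k choose 2))" by (intro power_mono) auto
      also have "\<dots> = exp (real (k + (k choose 2)))" by (simp add: exp_of_nat_mult[symmetric])
      also have "real (k + (k choose 2)) = k + k * (real k - 1) / 2"
        using elim(4) by (simp add: choose_two real_of_nat_div of_nat_diff)
      finally have p4: "(2 :: real) ^ (k + (k choose 2)) \<le> exp (k + k * (real k - 1) / 2)" .
      have "real (n choose k) * (2 ^ k * (1 / 2) ^ (l - k)) \<le>
          exp (k * (1 + ln (C * k))) * (exp (k * ln 2) * exp (- ln 2 * (c' * k * ln k - 1 - k)))"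
        using b1 p1 unfolding p3 by (intro mult_mono) auto
      also have "\<dots> = exp (k * (1 + ln (C * k)) + k * ln 2 - (d + 1 + \<epsilon>) * k * ln k + (1 + k) * ln 2)"
        by (simp add: exp_add[symmetric] d_def algebra_simps)
      also have "\<dots> \<le> exp (- \<epsilon> * k * ln k - ln 2)" using elim(2) by simp
      finally have t1: "real (n choose k) * (2 ^ k * (1 / 2) ^ (l - k)) \<le> exp (- \<epsilon> * k * ln k - ln 2)" .
      have "real (n choose k) * (real (l choose k) * 2 ^ (k + (k choose 2)) * (3 / 4) ^ (r - k)) \<le>
          exp (k * ln (C * (real k)\<^sup>2)) * (exp (k * ln (C * (real k)\<^sup>2)) * exp (k + k * (real k - 1) / 2) *
            exp (- (1 / 4) * (c * (real k)\<^sup>2 - 1 - k)))"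
        using b2 p2 p4 by (intro mult_mono) auto
      also have "\<dots> = exp (2 * k * ln (C * (real k)\<^sup>2) + k + k * (real k - 1) / 2 - ((\<delta> + 2) * (real k)\<^sup>2 - 1 - k) / 4)"
        unfolding exp_add[symmetric] by (rule arg_cong[of _ _ exp]) (simp add: \<delta>_def field_simps)
      also have "\<dots> \<le> exp (- \<epsilon> * k * ln k - ln 2)" using elim(3) by simp
      finally have "real (n choose k) * (real (l choose k) * 2 ^ (k + (k choose 2)) * (3 / 4) ^ (r - k)) \<le>
          exp (- \<epsilon> * k * ln k - ln 2)" .
      with t1 have "real (n choose k) * (2 ^ k * (1 / 2) ^ (l - k) +
          real (l choose k) * 2 ^ (k + (k choose 2)) * (3 / 4) ^ (r - k)) \<le> 2 * exp (- \<epsilon> * k * ln k - ln 2)"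
        by (simp only: distrib_left)
      also have "\<dots> = exp (- \<epsilon> * real k * ln (real k))" by (simp add: exp_diff)
      finally show "k \<le> l + r \<and> real ((l + r) choose k) * (2 ^ k * (1 / 2) ^ (l - k) +
          real (l choose k) * 2 ^ (k + (k choose 2)) * (3 / 4) ^ (r - k)) \<le> exp (- \<epsilon> * real k * ln (real k))"
        using \<open>k \<le> n\<close> by (simp add: n_def)
    qed
  qed
qed

theorem proposition9:
  fixes \<epsilon> c c' :: real
  assumes "\<epsilon> > 0" and "c > 2" and "c' > (1 + \<epsilon>) / ln 2"
  shows "\<exists>k\<^sub>0::nat. \<forall>k::nat. k > k\<^sub>0 \<longrightarrow>
    (\<forall>L R :: 'a set.
       finite L \<and> finite R \<and> L \<inter> R = {} \<and>
       int (card L) = \<lfloor>c' * real k * ln (real k)\<rfloor> \<and>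
       int (card R) = \<lfloor>c * (real k)\<^sup>2\<rfloor> \<longrightarrow>
       measure_pmf.prob (random_bipartite_graph L R) {G. vertex_minor_universal k G}
         \<ge> 1 - exp (- \<epsilon> * real k * ln (real k)))"
proof -
  \<comment> \<open>The bound is uniform in the sizes \<open>l\<close> and \<open>r\<close>, so one
    threshold serves all \<open>L\<close> and \<open>R\<close>.\<close>
  from eventually_failure_bound[OF assms] obtain k0 where k0:
    "\<And>k l r. k \<ge> k0 \<Longrightarrow> int l = \<lfloor>c' * real k * ln (real k)\<rfloor> \<Longrightarrow> int r = \<lfloor>c * (real k)\<^sup>2\<rfloor> \<Longrightarrow>
      k \<le> l + r \<and>
      real ((l + r) choose k) * (2 ^ k * (1 / 2) ^ (l - k) +
        real (l choose k) * 2 ^ (k + (k choose 2)) * (3 / 4) ^ (r - k)) \<le> exp (- \<epsilon> * real k * ln (real k))"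
    unfolding eventually_sequentially by blast
  show ?thesis
  proof (intro exI[of _ k0] allI impI, elim conjE)
    fix k and L R :: "'a set"
    assume "k0 < k" and fin: "finite L" "finite R" "L \<inter> R = {}"
      and card: "int (card L) = \<lfloor>c' * real k * ln (real k)\<rfloor>" "int (card R) = \<lfloor>c * (real k)\<^sup>2\<rfloor>"
    then have "k0 \<le> k" by simp
    note bound = k0[OF this card]
    show "measure_pmf.prob (random_bipartite_graph L R) {G. vertex_minor_universal k G}
        \<ge> 1 - exp (- \<epsilon> * real k * ln (real k))"
      using prob_vertex_minor_universal_ge[OF fin conjunct1[OF bound]] conjunct2[OF bound]
      by linarith
  qed
qed

end
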